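(* Let $(A,\cdot,\circ)$ be a transposed Novikov-Poisson algebra over $\mathbf{k}$. Then the following statements are equivalent: (a) $(A,\cdot,\circ)$ is a Novikov-Poisson algebra. (b) The identity $(x\cdot y)\circ z=z\circ(x\cdot y)$ holds for all $x,y,z\in A$. (c) $L_\cdot(x)\in\Gamma((A,\circ))$ for all $x\in A$. (d) $L_\circ(x)\in\Gamma((A,\cdot))$ for all $x\in A$.
   Context: $\mathbf{k}$ is a field of characteristic not equal to $2$; all binary operations are $\mathbf{k}$-bilinear and algebras need not be unital. For a binary operation $\ast$ on $A$ and $x\in A$, $L_\ast(x):A\to A$ is the linear map $L_\ast(x)(y)=x\ast y$. The centroid $\Gamma((A,\ast))$ is the set of linear maps $\phi:A\to A$ with $\phi(x\ast y)=x\ast\phi(y)=\phi(x)\ast y$ for all $x,y\in A$. A (left) Novikov algebra $(A,\circ)$ is a vector space with a binary operation satisfying $(x\circ y)\circ z=(x\circ z)\circ y$ and $(x\circ y)\circ z-x\circ(y\circ z)=(y\circ x)\circ z-y\circ(x\circ z)$ for all $x,y,z$. A transposed Novikov-Poisson algebra is a triple $(A,\cdot,\circ)$ where $(A,\cdot)$ is a commutative associative algebra, $(A,\circ)$ is a Novikov algebra, and for all $x,y,z\in A$: $(x\cdot y)\circ z=(x\cdot z)\circ y$ and $2z\cdot(x\circ y)=(z\cdot x)\circ y+x\circ(z\cdot y)$. A Novikov-Poisson algebra is a triple $(A,\cdot,\circ)$ where $(A,\cdot)$ is a commutative associative algebra, $(A,\circ)$ is a Novikov algebra, and for all $x,y,z\in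 A$: $(x\cdot y)\circ z=x\cdot(y\circ z)$ and $(x\circ y)\cdot z-(y\circ x)\cdot z=x\circ(y\cdot z)-y\circ(x\cdot z)$. *)

theory Defs
  imports Complex_Main
begin

text \<open>
  Every algebra has a whole type as its underlying set; the \<open>'k\<close>-vector space
  structure on it is given by the scalar multiplication \<open>scale\<close>. Algebras are
  neither assumed to be unital nor finite-dimensional.
\<close>

locale bilinear_operation = vector_space scale
  for scale :: "'k::field \<Rightarrow> 'a::ab_group_add \<Rightarrow> 'a" +
  fixes mult :: "'a \<Rightarrow> 'a \<Rightarrow> 'a"
  assumes linear_right: "\<And>x. Vector_Spaces.linear scale scale (\<lambda>y. mult x y)"
    and linear_left: "\<And>y. Vector_Spaces.linear scale scale (\<lambda>x. mult x y)"

locale comm_assoc_algebra = bilinear_operation scale dot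
  for scale :: "'k::field \<Rightarrow> 'a::ab_group_add \<Rightarrow> 'a"
    and dot :: "'a \<Rightarrow> 'a \<Rightarrow> 'a"  (infixl \<open>\<cdot>\<close> 70) +
  assumes dot_assoc: "\<And>x y z. (x \<cdot> y) \<cdot> z = x \<cdot> (y \<cdot> z)"
    and dot_commute: "\<And>x y. x \<cdot> y = y \<cdot> x"

locale novikov_algebra = bilinear_operation scale circ
  for scale :: "'k::field \<Rightarrow> 'a::ab_group_add \<Rightarrow> 'a"
    and circ :: "'a \<Rightarrow> 'a \<Rightarrow> 'a"  (infixl \<open>\<odot>\<close> 70) +
  assumes right_commute: "\<And>x y z. (x \<odot> y) \<odot> z = (x \<odot> z) \<odot> y"
    and left_symmetric:
      "\<And>x y z. (x \<odot> y) \<odot> z - x \<odot> (y \<odot> z) = (y \<odot> x) \<odot> z - y \<odot> (x \<odot> z)"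

locale transposed_novikov_poisson_algebra =
  comm_assoc_algebra scale dot + novikov_algebra scale circ
  for scale :: "'k::field \<Rightarrow> 'a::ab_group_add \<Rightarrow> 'a"
    and dot :: "'a \<Rightarrow> 'a \<Rightarrow> 'a"  (infixl \<open>\<cdot>\<close> 70)
    and circ :: "'a \<Rightarrow> 'a \<Rightarrow> 'a"  (infixl \<open>\<odot>\<close> 70) +
  assumes dot_circ_right_commute: "\<And>x y z. (x \<cdot> y) \<odot> z = (x \<cdot> z) \<odot> y"
    and transposed_compat:
      "\<And>x y z. scale 2 (z \<cdot> (x \<odot> y)) = (z \<cdot> x) \<odot> y + x \<odot> (z \<cdot> y)"

locale novikov_poisson_algebra =
  comm_assoc_algebra scale dot + novikov_algebra scale circ
  for scale :: "'k::field \<Rightarrow> 'a::ab_group_add \<Rightarrow> 'a"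
    and dot :: "'a \<Rightarrow> 'a \<Rightarrow> 'a"  (infixl \<open>\<cdot>\<close> 70)
    and circ :: "'a \<Rightarrow> 'a \<Rightarrow> 'a"  (infixl \<open>\<odot>\<close> 70) +
  assumes dot_circ_assoc: "\<And>x y z. (x \<cdot> y) \<odot> z = x \<cdot> (y \<odot> z)"
    and poisson_compat:
      "\<And>x y z. (x \<odot> y) \<cdot> z - (y \<odot> x) \<cdot> z = x \<odot> (y \<cdot> z) - y \<odot> (x \<cdot> z)"

definition left_mult :: "('a \<Rightarrow> 'a \<Rightarrow> 'a) \<Rightarrow> 'a \<Rightarrow> 'a \<Rightarrow> 'a" where
  "left_mult mult x = (\<lambda>y. mult x y)"

definition centroid ::
    "('k::field \<Rightarrow> 'a::ab_group_add \<Rightarrow> 'a) \<Rightarrow> ('a \<Rightarrow> 'a \<Rightarrow> 'a) \<Rightarrow> ('a \<Rightarrow> 'a) set" where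
  "centroid scale mult =
    {\<phi>. Vector_Spaces.linear scale scale \<phi> \<and>
        (\<forall>x y. \<phi> (mult x y) = mult x (\<phi> y) \<and> mult x (\<phi> y) = mult (\<phi> x) y)}"

end

theory Submission
  imports Defs
begin

text \<open>
  The compatibility identity says that \<open>z \<cdot> (x \<odot> y)\<close> is the midpoint of
  \<open>(z \<cdot> x) \<odot> y\<close> and \<open>x \<odot> (z \<cdot> y)\<close>. Hence it coincides with one of these
  two products as soon as it coincides with the other. All four conditions express
  this single coincidence, the \<^emph>\<open>mixed associativity\<close>
  \<open>(z \<cdot> x) \<odot> y = z \<cdot> (x \<odot> y)\<close>: the centroid conditions and the Novikov-Poisson
  axioms ask for one or both of the equalities between the midpoint and its endpoints.
  The commutation identity asks that the two endpoints agree, because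
  \<open>(z \<cdot> y) \<odot> x = (z \<cdot> x) \<odot> y\<close>; away from characteristic two this forces
  them to agree with the midpoint.
\<close>

lemma two_neq_zero_if_CHAR_neq_2:
  assumes "CHAR('k::field) \<noteq> 2"
  shows "(2::'k) \<noteq> 0"
proof
  assume "(2::'k) = 0"
  then have "CHAR('k) dvd 2"
    using of_nat_eq_0_iff_char_dvd[where 'a = 'k and n = 2] by simp
  then have "CHAR('k) \<le> 2" "CHAR('k) \<noteq> 0"
    by (simp_all add: dvd_imp_le) (metis dvd_0_left_iff gr0I zero_neq_numeral)
  then show False
    using assms CHAR_not_1'[where 'a = 'k] by linarith
qed

context transposed_novikov_poisson_algebra
begin

lemma double_dot_circ: "z \<cdot> (x \<odot> y) + z \<cdot> (x \<odot> y) = (z \<cdot> x) \<odot> y + x \<odot> (z \<cdot> y)"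
  using transposed_compat[of z x y] scale_left_distrib[of 1 1 "z \<cdot> (x \<odot> y)"] by simp

lemma midpoint_eq_left_iff_eq_right:
  "(z \<cdot> x) \<odot> y = z \<cdot> (x \<odot> y) \<longleftrightarrow> x \<odot> (z \<cdot> y) = z \<cdot> (x \<odot> y)"
  using double_dot_circ[of z x y] by (metis add_left_cancel add_right_cancel)

text \<open>
  Mixed associativity makes both endpoints equal to the midpoint, so antisymmetrizing
  \<open>x \<odot> (z \<cdot> y) = z \<cdot> (x \<odot> y)\<close> in \<open>x\<close> and \<open>y\<close> yields the second
  Novikov-Poisson axiom; the first one is mixed associativity itself.
\<close>

lemma novikov_poisson_iff_mixed_assoc:
  "novikov_poisson_algebra scale (\<cdot>) (\<odot>) \<longleftrightarrow>
    (\<forall>x y z. (z \<cdot> x) \<odot> y = z \<cdot> (x \<odot> y))"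
proof
  assume "novikov_poisson_algebra scale (\<cdot>) (\<odot>)"
  then show "\<forall>x y z. (z \<cdot> x) \<odot> y = z \<cdot> (x \<odot> y)"
    by (simp add: novikov_poisson_algebra.dot_circ_assoc)
next
  assume mixed: "\<forall>x y z. (z \<cdot> x) \<odot> y = z \<cdot> (x \<odot> y)"
  then have right: "x \<odot> (z \<cdot> y) = z \<cdot> (x \<odot> y)" for x y z
    using midpoint_eq_left_iff_eq_right by blast
  show "novikov_poisson_algebra scale (\<cdot>) (\<odot>)"
  proof
    show "(x \<cdot> y) \<odot> z = x \<cdot> (y \<odot> z)" for x y z
      using mixed by blast
    show "(x \<odot> y) \<cdot> z - (y \<odot> x) \<cdot> z = x \<odot> (y \<cdot> z) - y \<odot> (x \<cdot> z)" for x y z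
      using right[of x z y] right[of y z x] by (simp add: dot_commute)
  qed
qed

text \<open>
  The product \<open>(x \<cdot> y) \<odot> z\<close> is symmetric in all three arguments. The commutation
  identity therefore says that the two endpoints \<open>(z \<cdot> x) \<odot> y\<close> and
  \<open>x \<odot> (z \<cdot> y)\<close> coincide, and their midpoint is recovered by halving.
\<close>

lemma commutation_iff_mixed_assoc:
  assumes "CHAR('k) \<noteq> 2"
  shows "(\<forall>x y z. (x \<cdot> y) \<odot> z = z \<odot> (x \<cdot> y)) \<longleftrightarrow>
    (\<forall>x y z. (z \<cdot> x) \<odot> y = z \<cdot> (x \<odot> y))"
proof
  assume comm: "\<forall>x y z. (x \<cdot> y) \<odot> z = z \<odot> (x \<cdot> y)"
  show "\<forall>x y z. (z \<cdot> x) \<odot> y = z \<cdot> (x \<odot> y)"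
  proof (intro allI)
    fix x y z
    have "x \<odot> (z \<cdot> y) = (z \<cdot> x) \<odot> y"
      using comm dot_circ_right_commute[of z y x] by simp
    then have "scale 2 (z \<cdot> (x \<odot> y)) = scale 2 ((z \<cdot> x) \<odot> y)"
      using transposed_compat[of z x y] scale_left_distrib[of 1 1 "(z \<cdot> x) \<odot> y"] by simp
    then show "(z \<cdot> x) \<odot> y = z \<cdot> (x \<odot> y)"
      using two_neq_zero_if_CHAR_neq_2[OF assms] by simp
  qed
next
  assume mixed: "\<forall>x y z. (z \<cdot> x) \<odot> y = z \<cdot> (x \<odot> y)"
  then have right: "x \<odot> (z \<cdot> y) = z \<cdot> (x \<odot> y)" for x y z
    using midpoint_eq_left_iff_eq_right by blast
  show "\<forall>x y z. (x \<cdot> y) \<odot> z = z \<odot> (x \<cdot> y)"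
    using mixed right dot_circ_right_commute by metis
qed

lemma dot_mult_centroid_iff_mixed_assoc:
  "(\<forall>x. left_mult (\<cdot>) x \<in> centroid scale (\<odot>)) \<longleftrightarrow>
    (\<forall>x y z. (z \<cdot> x) \<odot> y = z \<cdot> (x \<odot> y))"
  using midpoint_eq_left_iff_eq_right comm_assoc_algebra_axioms
  unfolding centroid_def left_mult_def
  by (auto simp: bilinear_operation.linear_right comm_assoc_algebra_def)

text \<open>
  Membership of \<open>L\<^sub>\<odot>(x)\<close> in the centroid of the commutative product amounts to
  the other midpoint equality \<open>x \<odot> (z \<cdot> y) = z \<cdot> (x \<odot> y)\<close>. The second centroid
  equation \<open>z \<cdot> (x \<odot> y) = (x \<odot> z) \<cdot> y\<close> comes from exchanging \<open>y\<close> and \<open>z\<close>,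
  which leaves the left side \<open>x \<odot> (z \<cdot> y)\<close> unchanged.
\<close>

lemma circ_mult_centroid_iff_mixed_assoc:
  "(\<forall>x. left_mult (\<odot>) x \<in> centroid scale (\<cdot>)) \<longleftrightarrow>
    (\<forall>x y z. (z \<cdot> x) \<odot> y = z \<cdot> (x \<odot> y))"
proof
  assume "\<forall>x. left_mult (\<odot>) x \<in> centroid scale (\<cdot>)"
  then have "x \<odot> (z \<cdot> y) = z \<cdot> (x \<odot> y)" for x y z
    unfolding centroid_def left_mult_def by blast
  then show "\<forall>x y z. (z \<cdot> x) \<odot> y = z \<cdot> (x \<odot> y)"
    using midpoint_eq_left_iff_eq_right by blast
next
  assume "\<forall>x y z. (z \<cdot> x) \<odot> y = z \<cdot> (x \<odot> y)"
  then have right: "x \<odot> (z \<cdot> y) = z \<cdot> (x \<odot> y)" for x y z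
    using midpoint_eq_left_iff_eq_right by blast
  then have "z \<cdot> (x \<odot> y) = (x \<odot> z) \<cdot> y" for x y z
    by (metis dot_commute)
  moreover have "Vector_Spaces.linear scale scale (\<lambda>y. x \<odot> y)" for x
    using novikov_algebra_axioms
    by (simp add: novikov_algebra_def bilinear_operation.linear_right)
  ultimately show "\<forall>x. left_mult (\<odot>) x \<in> centroid scale (\<cdot>)"
    unfolding centroid_def left_mult_def using right by simp
qed

end

theorem proposition2p17:
  fixes scale :: "'k::field \<Rightarrow> 'a::ab_group_add \<Rightarrow> 'a"
    and dot :: "'a \<Rightarrow> 'a \<Rightarrow> 'a"  (infixl \<open>\<cdot>\<close> 70)
    and circ :: "'a \<Rightarrow> 'a \<Rightarrow> 'a"  (infixl \<open>\<odot>\<close> 70)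
  assumes "CHAR('k) \<noteq> 2"
    and "transposed_novikov_poisson_algebra scale (\<cdot>) (\<odot>)"
  shows "(novikov_poisson_algebra scale (\<cdot>) (\<odot>) \<longleftrightarrow>
            (\<forall>x y z. (x \<cdot> y) \<odot> z = z \<odot> (x \<cdot> y))) \<and>
         ((\<forall>x y z. (x \<cdot> y) \<odot> z = z \<odot> (x \<cdot> y)) \<longleftrightarrow>
            (\<forall>x. left_mult (\<cdot>) x \<in> centroid scale (\<odot>))) \<and>
         ((\<forall>x. left_mult (\<cdot>) x \<in> centroid scale (\<odot>)) \<longleftrightarrow>
            (\<forall>x. left_mult (\<odot>) x \<in> centroid scale (\<cdot>)))"
proof -
  interpret transposed_novikov_poisson_algebra scale "(\<cdot>)" "(\<odot>)"
    by (fact assms(2))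
  show ?thesis
    unfolding novikov_poisson_iff_mixed_assoc commutation_iff_mixed_assoc[OF assms(1)]
      dot_mult_centroid_iff_mixed_assoc circ_mult_centroid_iff_mixed_assoc
    by (intro conjI refl)
qed

end
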